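(* Let $0\le k\le n$ be integers. Then in $\hat{\mathbb Q}(\mathbf t)$ $$\left[\begin{matrix} n\\k\end{matrix}\right]_{q,t}=\sum_{\lambda}\mathrm{wt}(\lambda,k;q,t),$$ where the sum ranges over all partitions $\lambda$ whose Ferrers diagram fits inside a $k\times(n-k)$ rectangle (at most $k$ parts, each of size at most $n-k$). Furthermore, for each such $\lambda$, $$\lim_{t\to1}\mathrm{wt}(\lambda,k;q,t)=q^{|\lambda|}\quad\text{and}\quad \lim_{q\to1}\mathrm{wt}(\lambda,k;q,t^{\frac1{q-1}})=t^{|\lambda|},$$ where $|\lambda|$ is the sum of the parts of $\lambda$.
   Context: Ring: $\hat{\mathbb Q}(\mathbf t)$ is the field of rational functions over $\mathbb Q$ in algebraically independent indeterminates denoted $t^{q^r}$, $r\in\mathbb Z$ ($t=t^{q^0}$; $q$ is a formal symbol). For $f(q)=\sum_r c_rq^r\in\mathbb Z[q,q^{-1}]$ write $t^{f(q)}:=\prod_r (t^{q^r})^{c_r}$. The Frobenius automorphism $\varphi$ sends $t^{q^r}\mapsto t^{q^{r+1}}$, and $F(q,t^{q^m}):=\varphi^m F(q,t)$. For $u=t^{q^a-q^b}$ put $[q]_u:=\frac{1-\varphi(u)}{1-u}$ (which is $1+u+\cdots+u^{q-1}$ when $q$ is a positive integer). $(q,t)$-binomial: $n!_{q,t}:=\prod_{i=0}^{n-1}(1-t^{q^n-q^i})$ and $\left[\begin{smallmatrix} n\\k\end{smallmatrix}\right]_{q,t}:=\frac{n!_{q,t}}{k!_{q,t}\,(n-k)!_{q,t^{q^k}}}=\prod_{i=1}^k\frac{1-t^{q^n-q^{i-1}}}{1-t^{q^k-q^{i-1}}}$.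 Weight: let $\lambda$ be a partition with at most $k$ nonzero parts. For a cell $x$ in row $i$ and column $j$ of its Ferrers diagram (English notation, 1-indexed) put $\mathrm r(x)=i$, $\mathrm d(x)=j-i+k-1$, $e_k(x)=q^{\mathrm r(x)+\mathrm d(x)}-q^{\mathrm d(x)}$. Set $\mathrm{wt}(x,\lambda,k;q,t)=t^{e_k(x)}[q]_{t^{e_k(x)}}$ if $x$ is the bottom cell of $\lambda$ in its column, and $\mathrm{wt}(x,\lambda,k;q,t)=[q]_{t^{e_k(x)}}$ otherwise. Then $\mathrm{wt}(\lambda,k;q,t):=\prod_{x\in\lambda}\mathrm{wt}(x,\lambda,k;q,t)$. Limits: $\lim_{t\to1}F(q,t)$ means: fix an integer $q\ge2$, interpret each $t^{q^r}$ as the actual $q^r$-th power of the variable $t$ (so that $F$ becomes a polynomial in $t$), then set $t=1$. $\lim_{q\to1}F(q,t^{1/(q-1)})$ means the image of $F$ under the homomorphism, from the subfield generated by the quotients $t^{q^r}/t^{q^s}$ (where defined) to $\mathbb Q(t)$, sending $t^{q^r-q^s}\mapsto t^{r-s}$. *)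

theory Defs
  imports
    Complex_Main
    "HOL-Library.Poly_Mapping"
    "HOL-Computational_Algebra.Computational_Algebra"
begin

section \<open>The field of rational functions in the indeterminates \<open>t^(q^r)\<close>\<close>

text \<open>
  A monomial is a finitely supported exponent function on the index set \<open>\<int>\<close>; the indeterminate with
  index \<open>r\<close> is the one written \<open>t^(q^r)\<close>.
\<close>

type_synonym rpoly = "(int \<Rightarrow>\<^sub>0 nat) \<Rightarrow>\<^sub>0 rat"
type_synonym qhat = "rpoly fract"

definition tvar :: "int \<Rightarrow> qhat" where
  "tvar r = Fract (Poly_Mapping.single (Poly_Mapping.single r 1) 1) 1"

text \<open>
  Laurent polynomials in the formal symbol \<open>q\<close> with integer coefficients are elements of
  \<^typ>\<open>int \<Rightarrow>\<^sub>0 int\<close>, the value at \<open>r\<close> being the coefficient of \<open>q^r\<close>.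
\<close>

definition qpow :: "int \<Rightarrow> (int \<Rightarrow>\<^sub>0 int)" where
  "qpow r = Poly_Mapping.single r 1"

definition texp :: "(int \<Rightarrow>\<^sub>0 int) \<Rightarrow> qhat" where
  "texp f = (\<Prod>r\<in>Poly_Mapping.keys f. tvar r powi Poly_Mapping.lookup f r)"


section \<open>Homomorphisms given by their values on generators\<close>

text \<open>
  The graph of the (partial) field homomorphism that has the prescribed values \<open>G\<close>. It is defined on
  those elements of the subfield generated by the domain of \<open>G\<close> that can be written without
  inverting an element with image \<open>0\<close>. For the sets \<open>G\<close> used below it is single-valued, as proved in
  \<open>hom_graph_unique\<close> and \<open>lim_q1_unique\<close>.
\<close>

inductive hom_graph :: "('a::field \<times> 'b::field) set \<Rightarrow> 'a \<Rightarrow> 'b \<Rightarrow> bool"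
  for G where
  gen: "(x, y) \<in> G \<Longrightarrow> hom_graph G x y"
| one: "hom_graph G 1 1"
| diff: "hom_graph G x y \<Longrightarrow> hom_graph G x' y' \<Longrightarrow> hom_graph G (x - x') (y - y')"
| mult: "hom_graph G x y \<Longrightarrow> hom_graph G x' y' \<Longrightarrow> hom_graph G (x * x') (y * y')"
| inv: "hom_graph G x y \<Longrightarrow> y \<noteq> 0 \<Longrightarrow> hom_graph G (inverse x) (inverse y)"

text \<open>The Frobenius automorphism; see \<open>frob_tvar\<close>, \<open>frob_add\<close>, \<open>frob_mult\<close>, \<open>bij_frob\<close> below.\<close>

definition frob :: "qhat \<Rightarrow> qhat" where
  "frob F = (THE F'. hom_graph (range (\<lambda>r. (tvar r, tvar (r + 1)))) F F')"


section \<open>The two limits\<close>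

text \<open>
  \<open>lim_t1 q F c\<close>: for the integer \<open>q\<close>, reading \<open>t^(q^r)\<close> as the actual \<open>q^r\<close>-th power of one
  variable \<open>t\<close> turns \<open>F\<close> into a polynomial in \<open>t\<close> whose value at \<open>t = 1\<close> is \<open>c\<close>. As \<open>r\<close> may be
  negative, the powers are taken in the fraction field of the ring of polynomials in \<open>t\<close> with
  rational exponents; there \<open>tpower s\<close> is \<open>t^s\<close>.
\<close>

definition tpower :: "rat \<Rightarrow> (rat \<Rightarrow>\<^sub>0 rat) fract" where
  "tpower s = Fract (Poly_Mapping.single s 1) 1"

definition poly_in_t :: "rat poly \<Rightarrow> (rat \<Rightarrow>\<^sub>0 rat) fract" where
  "poly_in_t P = (\<Sum>i\<le>degree P. Fract (Poly_Mapping.single 0 (coeff P i)) 1 * tpower 1 ^ i)"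

definition lim_t1 :: "nat \<Rightarrow> qhat \<Rightarrow> rat \<Rightarrow> bool" where
  "lim_t1 q F c \<longleftrightarrow>
     (\<exists>P. hom_graph (range (\<lambda>r. (tvar r, tpower (of_nat q powi r)))) F (poly_in_t P) \<and> poly P 1 = c)"

text \<open>
  \<open>lim_q1 F g\<close>: the limit of \<open>F(q, t^(1/(q-1)))\<close> for \<open>q \<rightarrow> 1\<close> exists and equals \<open>g \<in> \<rat>(t)\<close>.
\<close>

definition ratfun_t :: "rat poly fract" where
  "ratfun_t = Fract [:0, 1:] 1"

definition lim_q1 :: "qhat \<Rightarrow> rat poly fract \<Rightarrow> bool" where
  "lim_q1 F g \<longleftrightarrow> hom_graph {(tvar r / tvar s, ratfun_t powi (r - s)) | r s. True} F g"


section \<open>The \<open>(q,t)\<close>-binomial coefficient\<close>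

definition qt_fact :: "nat \<Rightarrow> qhat" where
  "qt_fact n = (\<Prod>i<n. 1 - texp (qpow (int n) - qpow (int i)))"

definition qt_binomial :: "nat \<Rightarrow> nat \<Rightarrow> qhat" where
  "qt_binomial n k = qt_fact n / (qt_fact k * (frob ^^ k) (qt_fact (n - k)))"

definition q_bracket :: "qhat \<Rightarrow> qhat" where
  "q_bracket u = (1 - frob u) / (1 - u)"


section \<open>Partitions and their weights\<close>

text \<open>A partition is the weakly decreasing list of its nonzero parts.\<close>

definition is_partition :: "nat list \<Rightarrow> bool" where
  "is_partition l \<longleftrightarrow> sorted_wrt (\<ge>) l \<and> 0 \<notin> set l"

definition box_partitions :: "nat \<Rightarrow> nat \<Rightarrow> nat list set" where
  "box_partitions k m = {l. is_partition l \<and> length l \<le> k \<and> (\<forall>p\<in>set l. p \<le> m)}"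

text \<open>Cells \<open>(i, j)\<close> (row, column) of the Ferrers diagram, in English notation and counted from 1.\<close>

definition cells :: "nat list \<Rightarrow> (nat \<times> nat) set" where
  "cells l = {(i, j). 1 \<le> i \<and> i \<le> length l \<and> 1 \<le> j \<and> j \<le> l ! (i - 1)}"

definition is_bottom :: "nat list \<Rightarrow> nat \<times> nat \<Rightarrow> bool" where
  "is_bottom l x \<longleftrightarrow> x \<in> cells l \<and> (\<forall>i. (i, snd x) \<in> cells l \<longrightarrow> i \<le> fst x)"

definition cell_r :: "nat \<times> nat \<Rightarrow> int" where
  "cell_r x = int (fst x)"

definition cell_d :: "nat \<Rightarrow> nat \<times> nat \<Rightarrow> int" where
  "cell_d k x = int (snd x) - int (fst x) + int k - 1"

definition cell_e :: "nat \<Rightarrow> nat \<times> nat \<Rightarrow> (int \<Rightarrow>\<^sub>0 int)" where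
  "cell_e k x = qpow (cell_r x + cell_d k x) - qpow (cell_d k x)"

definition cell_wt :: "nat list \<Rightarrow> nat \<Rightarrow> nat \<times> nat \<Rightarrow> qhat" where
  "cell_wt l k x =
     (if is_bottom l x then texp (cell_e k x) * q_bracket (texp (cell_e k x))
      else q_bracket (texp (cell_e k x)))"

definition wt :: "nat list \<Rightarrow> nat \<Rightarrow> qhat" where
  "wt l k = (\<Prod>x\<in>cells l. cell_wt l k x)"


section \<open>The definitions above are meaningful\<close>

lemma finite_cells: "finite (cells l)"
proof (rule finite_subset)
  show "cells l \<subseteq> {..length l} \<times> {..sum_list l}"
    by (auto simp: cells_def intro: order_trans[OF _ elem_le_sum_list])
qed simp

lemma finite_box_partitions: "finite (box_partitions k m)"
proof (rule finite_subset)
  show "box_partitions k m \<subseteq> {l. set l \<subseteq> {..m} \<and> length l \<le> k}"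
    by (auto simp: box_partitions_def)
  show "finite {l. set l \<subseteq> {..m} \<and> length l \<le> k}"
    by (rule finite_lists_length_le) simp
qed

instance fract :: ("{idom, ring_char_0}") field_char_0
proof
  show "inj (of_nat :: nat \<Rightarrow> 'a fract)"
    by (rule injI) (simp add: of_nat_fract eq_fract)
qed

definition mon_val :: "(int \<Rightarrow> 'b::field_char_0) \<Rightarrow> (int \<Rightarrow>\<^sub>0 nat) \<Rightarrow> 'b" where
  "mon_val v m = (\<Prod>r\<in>Poly_Mapping.keys m. v r ^ Poly_Mapping.lookup m r)"

definition poly_val :: "(int \<Rightarrow> 'b::field_char_0) \<Rightarrow> rpoly \<Rightarrow> 'b" where
  "poly_val v p = (\<Sum>m\<in>Poly_Mapping.keys p. of_rat (Poly_Mapping.lookup p m) * mon_val v m)"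

lemma mon_val_superset:
  assumes "finite A" "Poly_Mapping.keys m \<subseteq> A"
  shows "mon_val v m = (\<Prod>r\<in>A. v r ^ Poly_Mapping.lookup m r)"
  unfolding mon_val_def by (rule prod.mono_neutral_left) (use assms in \<open>auto simp: in_keys_iff\<close>)

lemma mon_val_add: "mon_val v (m + m') = mon_val v m * mon_val v m'"
proof -
  let ?A = "Poly_Mapping.keys m \<union> Poly_Mapping.keys m'"
  have "mon_val v (m + m') = (\<Prod>r\<in>?A. v r ^ Poly_Mapping.lookup (m + m') r)"
    by (rule mon_val_superset) (simp_all add: Poly_Mapping.keys_add)
  also have "\<dots> = (\<Prod>r\<in>?A. v r ^ Poly_Mapping.lookup m r) * (\<Prod>r\<in>?A. v r ^ Poly_Mapping.lookup m' r)"
    by (simp add: lookup_add power_add prod.distrib)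
  also have "\<dots> = mon_val v m * mon_val v m'"
    using mon_val_superset[of ?A m v] mon_val_superset[of ?A m' v] by simp
  finally show ?thesis .
qed

lemma poly_val_superset:
  assumes "finite A" "Poly_Mapping.keys p \<subseteq> A"
  shows "poly_val v p = (\<Sum>m\<in>A. of_rat (Poly_Mapping.lookup p m) * mon_val v m)"
  unfolding poly_val_def by (rule sum.mono_neutral_left) (use assms in \<open>auto simp: in_keys_iff\<close>)

lemma poly_val_add: "poly_val v (p + p') = poly_val v p + poly_val v p'"
proof -
  let ?A = "Poly_Mapping.keys p \<union> Poly_Mapping.keys p'"
  have "poly_val v (p + p') = (\<Sum>m\<in>?A. of_rat (Poly_Mapping.lookup (p + p') m) * mon_val v m)"
    by (rule poly_val_superset) (simp_all add: Poly_Mapping.keys_add)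
  also have "\<dots> = (\<Sum>m\<in>?A. of_rat (Poly_Mapping.lookup p m) * mon_val v m)
                + (\<Sum>m\<in>?A. of_rat (Poly_Mapping.lookup p' m) * mon_val v m)"
    by (simp add: lookup_add of_rat_add sum.distrib algebra_simps)
  also have "\<dots> = poly_val v p + poly_val v p'"
    using poly_val_superset[of ?A p v] poly_val_superset[of ?A p' v] by simp
  finally show ?thesis .
qed

lemma poly_val_0 [simp]: "poly_val v 0 = 0"
  by (simp add: poly_val_def)

lemma poly_val_single: "poly_val v (Poly_Mapping.single m c) = of_rat c * mon_val v m"
  by (simp add: poly_val_def)

lemma poly_val_1 [simp]: "poly_val v 1 = 1"
  unfolding single_one[symmetric] by (simp only: poly_val_single) (simp add: mon_val_def)

lemma poly_val_diff: "poly_val v (p - p') = poly_val v p - poly_val v p'"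
  using poly_val_add[of v "p - p'" p'] by simp

lemma rpoly_induct [case_names zero single_add]:
  fixes p :: "'a \<Rightarrow>\<^sub>0 'c::comm_monoid_add"
  assumes "P 0" "\<And>m c p. P p \<Longrightarrow> P (Poly_Mapping.single m c + p)"
  shows "P p"
proof -
  have "P (\<Sum>m\<in>A. Poly_Mapping.single m (Poly_Mapping.lookup p m))" if "finite A" for A
    using that by (induction A rule: finite_induct) (auto intro: assms)
  moreover have "(\<Sum>m\<in>Poly_Mapping.keys p. Poly_Mapping.single m (Poly_Mapping.lookup p m)) = p"
    by (rule poly_mapping_eqI) (simp add: lookup_sum lookup_single when_def in_keys_iff)
  ultimately show ?thesis by (metis finite_keys)
qed

lemma poly_val_mult: "poly_val v (p * p') = poly_val v p * poly_val v p'"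
proof (induction p rule: rpoly_induct)
  case (single_add m c p)
  have "poly_val v (Poly_Mapping.single m c * p') = of_rat c * mon_val v m * poly_val v p'"
    by (induction p' rule: rpoly_induct)
       (simp_all add: distrib_left poly_val_add mult_single poly_val_single mon_val_add of_rat_mult)
  then show ?case
    using single_add by (simp add: distrib_right poly_val_add poly_val_single)
qed simp

lemma hom_graph_zero: "hom_graph G 0 0"
  using hom_graph.diff[OF hom_graph.one hom_graph.one] by simp

lemma hom_graph_add: "hom_graph G x y \<Longrightarrow> hom_graph G x' y' \<Longrightarrow> hom_graph G (x + x') (y + y')"
  using hom_graph.diff[of G x y "- x'" "- y'"] hom_graph.diff[OF hom_graph_zero, of G x' y'] by simp

lemma hom_graph_power: "hom_graph G x y \<Longrightarrow> hom_graph G (x ^ n) (y ^ n)"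
  by (induction n) (auto intro: hom_graph.intros)

lemma hom_graph_prod:
  "(\<And>i. i \<in> A \<Longrightarrow> hom_graph G (f i) (g i)) \<Longrightarrow> hom_graph G (\<Prod>i\<in>A. f i) (\<Prod>i\<in>A. g i)"
  by (induction A rule: infinite_finite_induct) (auto intro: hom_graph.intros)

lemma hom_graph_of_rat:
  fixes G :: "('a::field_char_0 \<times> 'b::field_char_0) set"
  shows "hom_graph G (of_rat c) (of_rat c)"
proof -
  have nat: "hom_graph G (of_nat n) (of_nat n)" for n
    by (induction n) (auto intro: hom_graph_zero hom_graph_add hom_graph.one)
  have int: "hom_graph G (of_int n) (of_int n)" for n
    using hom_graph.diff[OF nat nat, of "nat n" "nat (- n)"]
    by (cases "n \<ge> 0") auto
  obtain a b where c: "c = of_int a / of_int b" "b > 0"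
    by (metis Fract_of_int_quotient Rat_cases)
  show ?thesis
    using hom_graph.mult[OF int hom_graph.inv[OF int], of b a] c
    by (simp add: of_rat_divide divide_inverse of_rat_mult of_rat_inverse)
qed

lemma hom_graph_imp_quotient:
  assumes "hom_graph (range (\<lambda>r. (tvar r, v r))) F (f :: 'b::field_char_0)"
  shows "\<exists>a b. F = Fract a b \<and> b \<noteq> 0 \<and> poly_val v b \<noteq> 0 \<and> f = poly_val v a / poly_val v b"
  using assms
proof induction
  case (gen x y)
  then obtain r where "x = tvar r" "y = v r" by auto
  then show ?case
    by (intro exI[of _ "Poly_Mapping.single (Poly_Mapping.single r 1) 1"] exI[of _ 1])
       (simp add: tvar_def poly_val_single mon_val_def)
next
  case one
  show ?case by (intro exI[of _ 1]) (simp add: One_fract_def)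
next
  case (diff x y x' y')
  then obtain a b c d where *:
    "x = Fract a b" "b \<noteq> 0" "poly_val v b \<noteq> 0" "y = poly_val v a / poly_val v b"
    "x' = Fract c d" "d \<noteq> 0" "poly_val v d \<noteq> 0" "y' = poly_val v c / poly_val v d"
    by blast
  show ?case
    by (intro exI[of _ "a * d - c * b"] exI[of _ "b * d"])
       (use * in \<open>simp add: poly_val_diff poly_val_mult diff_frac_eq\<close>)
next
  case (mult x y x' y')
  then obtain a b c d where *:
    "x = Fract a b" "b \<noteq> 0" "poly_val v b \<noteq> 0" "y = poly_val v a / poly_val v b"
    "x' = Fract c d" "d \<noteq> 0" "poly_val v d \<noteq> 0" "y' = poly_val v c / poly_val v d"
    by blast
  show ?case
    by (intro exI[of _ "a * c"] exI[of _ "b * d"])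
       (use * in \<open>simp add: poly_val_mult\<close>)
next
  case (inv x y)
  then obtain a b where *:
    "x = Fract a b" "b \<noteq> 0" "poly_val v b \<noteq> 0" "y = poly_val v a / poly_val v b"
    by blast
  show ?case
    by (intro exI[of _ b] exI[of _ a]) (use * inv in auto)
qed

lemma hom_graph_unique:
  assumes "hom_graph (range (\<lambda>r. (tvar r, v r))) F f" "hom_graph (range (\<lambda>r. (tvar r, v r))) F f'"
  shows "f = (f' :: 'b::field_char_0)"
proof -
  obtain a b where 1:
    "F = Fract a b" "b \<noteq> 0" "poly_val v b \<noteq> 0" "f = poly_val v a / poly_val v b"
    using hom_graph_imp_quotient[OF assms(1)] by blast
  obtain c d where 2:
    "F = Fract c d" "d \<noteq> 0" "poly_val v d \<noteq> 0" "f' = poly_val v c / poly_val v d"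
    using hom_graph_imp_quotient[OF assms(2)] by blast
  have "a * d = c * b"
    using 1(1,2) 2(1,2) eq_fract(1)[of b d a c] by simp
  then have "poly_val v a * poly_val v d = poly_val v c * poly_val v b"
    by (metis poly_val_mult)
  with 1(3) 2(3) have "poly_val v a / poly_val v b = poly_val v c / poly_val v d"
    by (simp add: frac_eq_eq)
  with 1(4) 2(4) show ?thesis by simp
qed

lemma poly_in_t_eq:
  "poly_in_t P = Fract (\<Sum>i\<le>degree P. Poly_Mapping.single (of_nat i) (coeff P i)) 1"
proof -
  have pow: "tpower 1 ^ i = tpower (of_nat i)" for i
    by (induction i)
       (simp_all add: tpower_def mult_single One_fract_def single_one[symmetric] del: single_one)
  have sum: "(\<Sum>i\<in>A. Fract (f i) 1) = Fract (\<Sum>i\<in>A. f i) 1"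
    for A and f :: "nat \<Rightarrow> (rat \<Rightarrow>\<^sub>0 rat)"
    by (induction A rule: infinite_finite_induct) (simp_all add: Zero_fract_def)
  show ?thesis
    unfolding poly_in_t_def pow by (simp add: tpower_def mult_single sum)
qed

lemma poly_in_t_inject: "poly_in_t P = poly_in_t Q \<Longrightarrow> P = Q"
proof -
  let ?S = "\<lambda>R :: rat poly. \<Sum>i\<le>degree R. Poly_Mapping.single (of_nat i :: rat) (coeff R i)"
  have c: "Poly_Mapping.lookup (?S R) (of_nat j) = coeff R j" for R j
    by (auto simp: lookup_sum lookup_single when_def coeff_eq_0 not_le)
  assume "poly_in_t P = poly_in_t Q"
  then have "?S P * 1 = ?S Q * 1"
    unfolding poly_in_t_eq by (subst (asm) eq_fract(1)) auto
  then have "Poly_Mapping.lookup (?S P) (of_nat j) = Poly_Mapping.lookup (?S Q) (of_nat j)" for j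
    by (simp only: mult_1_right)
  then show "P = Q"
    unfolding c by (rule poly_eqI)
qed

lemma lim_t1_unique:
  assumes "lim_t1 q F c" "lim_t1 q F c'"
  shows "c = c'"
proof -
  let ?h = "hom_graph (range (\<lambda>r. (tvar r, tpower (of_nat q powi r)))) F"
  obtain P P' where "?h (poly_in_t P)" "poly P 1 = c" "?h (poly_in_t P')" "poly P' 1 = c'"
    using assms unfolding lim_t1_def by auto
  moreover from this have "P = P'"
    by (intro poly_in_t_inject hom_graph_unique)
  ultimately show ?thesis by simp
qed

lemma ratfun_t_nonzero: "ratfun_t \<noteq> 0"
  by (simp add: ratfun_t_def Zero_fract_def eq_fract)

lemma hom_graph_powi:
  assumes "hom_graph G x y" "y \<noteq> 0"
  shows "hom_graph G (x powi n) (y powi n)"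
  using assms by (auto simp: power_int_def intro!: hom_graph_power hom_graph.inv)

lemma lim_q1_imp_hom_graph:
  assumes "lim_q1 F g"
  shows "hom_graph (range (\<lambda>r. (tvar r, ratfun_t powi r))) F g"
  using assms unfolding lim_q1_def
proof induction
  case (gen x y)
  then obtain r s where "x = tvar r * inverse (tvar s)" "y = ratfun_t powi r * inverse (ratfun_t powi s)"
    by (auto simp: divide_inverse power_int_diff ratfun_t_nonzero)
  moreover have "hom_graph (range (\<lambda>r. (tvar r, ratfun_t powi r))) (tvar r) (ratfun_t powi r)" for r
    by (rule hom_graph.gen) simp
  ultimately show ?case
    by (simp add: hom_graph.mult hom_graph.inv ratfun_t_nonzero)
qed (simp_all add: hom_graph.one hom_graph.diff hom_graph.mult hom_graph.inv)

lemma lim_q1_unique: "lim_q1 F g \<Longrightarrow> lim_q1 F g' \<Longrightarrow> g = g'"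
  using hom_graph_unique lim_q1_imp_hom_graph by blast

lemma of_rat_qhat: "of_rat c = (Fract (Poly_Mapping.single 0 c) 1 :: qhat)"
proof -
  have int: "of_int n = (Fract (Poly_Mapping.single 0 (of_int n)) 1 :: qhat)" for n
  proof -
    have "Fract (of_nat m) 1 = (of_nat m :: qhat)" for m
      by (simp add: of_nat_fract)
    then have "of_int n = (Fract (of_int n) 1 :: qhat)"
      by (cases n rule: int_cases2) (simp_all add: minus_fract[symmetric] del: minus_fract)
    then show ?thesis by simp
  qed
  obtain a b where c: "c = of_int a / of_int b" "b > 0"
    by (metis Fract_of_int_quotient Rat_cases)
  have b: "Poly_Mapping.single (0::int \<Rightarrow>\<^sub>0 nat) (of_int b :: rat) \<noteq> 0"
    using c(2) by (metis lookup_single_eq lookup_zero of_int_eq_0_iff less_irrefl)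
  have "of_rat c = (of_int a / of_int b :: qhat)"
    using c by (simp add: of_rat_divide)
  also have "\<dots> = Fract (Poly_Mapping.single 0 (of_int a)) (Poly_Mapping.single 0 (of_int b))"
    by (simp only: int divide_fract) simp
  also have "\<dots> = Fract (Poly_Mapping.single 0 c) 1"
    using b c by (subst eq_fract) (simp_all del: single_of_int add: mult_single)
  finally show ?thesis .
qed

lemma single_eq_mon_val:
  "(Fract (Poly_Mapping.single m c) 1 :: qhat) = of_rat c * mon_val tvar m"
proof -
  have pow: "tvar r ^ n = Fract (Poly_Mapping.single (Poly_Mapping.single r n) 1) 1" for r n
  proof (induction n)
    case 0
    show ?case by (simp add: One_fract_def)
  next
    case (Suc n)
    then show ?case
      by (simp add: tvar_def mult_single single_add[symmetric])
  qed
  have "mon_val tvar m = Fract (Poly_Mapping.single m 1) 1"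
  proof (induction m rule: rpoly_induct)
    case zero
    show ?case by (simp add: mon_val_def One_fract_def)
  next
    case (single_add r n m)
    have "mon_val tvar (Poly_Mapping.single r n) = tvar r ^ n"
      by (cases "n = 0") (simp_all add: mon_val_def)
    with single_add pow show ?case
      by (simp add: mon_val_add mult_single)
  qed
  then show ?thesis by (simp add: of_rat_qhat mult_single)
qed

lemma hom_graph_poly_val: "hom_graph (range (\<lambda>r. (tvar r, v r))) (Fract p 1) (poly_val v p)"
proof (induction p rule: rpoly_induct)
  case zero
  show ?case by (simp add: hom_graph_zero flip: Zero_fract_def)
next
  case (single_add m c p)
  have "hom_graph (range (\<lambda>r. (tvar r, v r))) (Fract (Poly_Mapping.single m c) 1)
          (poly_val v (Poly_Mapping.single m c))"
    unfolding single_eq_mon_val poly_val_single mon_val_def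
    by (intro hom_graph.mult hom_graph_of_rat hom_graph_prod hom_graph_power hom_graph.gen) auto
  from hom_graph_add[OF this single_add] show ?case
    by (simp add: poly_val_add)
qed

lemma hom_graph_converse:
  assumes "hom_graph (range (\<lambda>r. (tvar r, v r))) F (f :: 'b::field_char_0)"
  shows "hom_graph (range (\<lambda>r. (v r, tvar r))) f F"
  using assms
proof induction
  case (gen x y)
  then show ?case by (intro hom_graph.gen) auto
next
  case (inv x y)
  then have "x \<noteq> 0"
    using hom_graph_unique hom_graph_zero by blast
  with inv show ?case by (simp add: hom_graph.inv)
qed (simp_all add: hom_graph.one hom_graph.diff hom_graph.mult hom_graph.inv)

abbreviation shift_graph :: "int \<Rightarrow> (qhat \<times> qhat) set" where
  "shift_graph s \<equiv> range (\<lambda>r. (tvar r, tvar (r + s)))"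

lemma shift_graph_converse: "hom_graph (shift_graph s) F F' \<Longrightarrow> hom_graph (shift_graph (- s)) F' F"
proof -
  have "range (\<lambda>r. (tvar (r + s), tvar r)) = shift_graph (- s)"
  proof -
    have "range (\<lambda>r. (tvar (r + s), tvar r)) = (\<lambda>r. (tvar r, tvar (r + - s))) ` range (\<lambda>r. r + s)"
      by (subst image_image) simp
    moreover have "range (\<lambda>r. r + s) = UNIV"
      by (rule surjI[of _ "\<lambda>r. r - s"]) simp
    ultimately show ?thesis by (simp only:)
  qed
  with hom_graph_converse[of "\<lambda>r. tvar (r + s)" F F']
  show "hom_graph (shift_graph s) F F' \<Longrightarrow> hom_graph (shift_graph (- s)) F' F"
    by simp
qed

lemma shift_graph_total: "\<exists>F'. hom_graph (shift_graph s) F F'"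
proof (cases F)
  case (Fract a b)
  let ?v = "\<lambda>r. tvar (r + s)"
  have "poly_val ?v b \<noteq> 0"
  proof
    assume "poly_val ?v b = 0"
    then have "hom_graph (shift_graph (- s)) 0 (Fract b 1)"
      using shift_graph_converse[OF hom_graph_poly_val[of ?v b]] by simp
    then have "Fract b 1 = 0"
      using hom_graph_zero by (rule hom_graph_unique)
    with Fract show False by (simp add: Zero_fract_def eq_fract)
  qed
  then have "hom_graph (shift_graph s) (Fract a 1 * inverse (Fract b 1)) (poly_val ?v a * inverse (poly_val ?v b))"
    by (intro hom_graph.mult hom_graph.inv hom_graph_poly_val)
  moreover have "Fract a 1 * inverse (Fract b 1) = F"
    using Fract by simp
  ultimately show ?thesis by metis
qed

lemma frob_iff: "frob F = F' \<longleftrightarrow> hom_graph (shift_graph 1) F F'"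
proof -
  have "\<exists>!F'. hom_graph (shift_graph 1) F F'"
    using shift_graph_total[of 1 F] hom_graph_unique[of "\<lambda>r. tvar (r + 1)" F] by auto
  from theI'[OF this] the1_equality[OF this] show ?thesis
    unfolding frob_def by blast
qed

lemma frob_graph: "hom_graph (shift_graph 1) F (frob F)"
  by (simp flip: frob_iff)

lemma frob_tvar: "frob (tvar r) = tvar (r + 1)"
  by (auto simp: frob_iff intro: hom_graph.gen)

lemma frob_1: "frob 1 = 1"
  by (auto simp: frob_iff intro: hom_graph.one)

lemma frob_add: "frob (F + F') = frob F + frob F'"
  using hom_graph_add[OF frob_graph frob_graph] by (simp only: frob_iff)

lemma frob_mult: "frob (F * F') = frob F * frob F'"
  using hom_graph.mult[OF frob_graph frob_graph] by (simp only: frob_iff)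

lemma bij_frob: "bij frob"
proof (rule bijI)
  show "inj frob"
  proof (rule injI)
    fix F F' assume "frob F = frob F'"
    then have "hom_graph (shift_graph (- 1)) (frob F) F" "hom_graph (shift_graph (- 1)) (frob F) F'"
      using shift_graph_converse[OF frob_graph[of F]] shift_graph_converse[OF frob_graph[of F']]
      by simp_all
    then show "F = F'" by (rule hom_graph_unique)
  qed
  show "surj frob"
  proof (rule surjI)
    fix F'
    have "hom_graph (shift_graph (- 1)) F' (SOME F. hom_graph (shift_graph (- 1)) F' F)"
      using shift_graph_total by (rule someI_ex)
    then show "frob (SOME F. hom_graph (shift_graph (- 1)) F' F) = F'"
      using shift_graph_converse[of "- 1"] by (simp only: frob_iff minus_minus)
  qed
qed

end

theory Submission
  imports Defs
begin

text \<open>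
  Cut a partition in the box into its columns. The weight of a cell depends on the partition only
  through the question whether the cell is a bottom cell, so the weights of the cells in the first
  column, of height \<open>g\<close>, multiply to a quantity \<open>col_wt k g\<close> that depends on \<open>g\<close> and \<open>k\<close> alone. The
  remaining columns form a partition \<open>l\<close> whose columns have height at most \<open>g\<close>; moving them one step
  to the left lowers \<open>d\<close> by one, which replacing \<open>k\<close> by \<open>k + 1\<close> makes good. Hence the first column
  splits off as a factor (\<open>wt_add_column\<close>):
  the weight for \<open>k\<close> is \<open>col_wt k g\<close> times the weight of \<open>l\<close> for \<open>k + 1\<close>.

  The key to the summation is to let the bound \<open>h\<close> on the height of the columns vary independently
  of \<open>k\<close>. Writing \<open>t_r\<close> for the indeterminate \<open>t^(q^r)\<close>, the generating function over the partitions
  with at most \<open>h\<close> parts of size at most \<open>m\<close> is the truncated product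
    \<open>(\<Prod>i=1..h. (1 - t_(k+m) / t_(k-i)) / (1 - t_k / t_(k-i)))\<close>,
  called \<open>box_prod k m h\<close> below; the \<open>(q,t)\<close>-binomial coefficient is its value at \<open>h = k\<close> and
  \<open>m = n - k\<close> (\<open>qt_binomial_eq_box_prod\<close>). By induction on \<open>m\<close>, this reduces to the identity
    \<open>(\<Sum>g\<le>h. col_wt k g * box_prod (k + 1) m g) = box_prod k (m + 1) h\<close>.
  Its left-hand side telescopes: the numerators of the brackets in \<open>col_wt k g\<close> are the denominators
  of \<open>box_prod (k + 1) m g\<close>, and what is left over is exactly the increment of the right-hand side from
  \<open>h = g - 1\<close> to \<open>h = g\<close> (\<open>box_prod_Suc\<close>).

  Both limits are multiplicative, so it is enough to find them for one column of height \<open>g\<close>. For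
  \<open>t \<rightarrow> 1\<close> each of its \<open>g\<close> brackets becomes a geometric sum of \<open>q\<close> powers of \<open>t\<close>, with limit \<open>q\<close>.
  For \<open>q \<rightarrow> 1\<close> the numerator and the denominator of a bracket have the same image, so only the
  monomial at the bottom cell of the column survives, with image \<open>t^g\<close>.
\<close>

section \<open>Ratios of two indeterminates\<close>

definition tratio :: "int \<Rightarrow> int \<Rightarrow> qhat" where
  "tratio a b = tvar a / tvar b"

lemma tvar_eq_iff: "tvar a = tvar b \<longleftrightarrow> a = b"
proof
  assume "tvar a = tvar b"
  then have "Poly_Mapping.single (Poly_Mapping.single a (1::nat)) (1::rat) =
             Poly_Mapping.single (Poly_Mapping.single b 1) 1"
    by (simp add: tvar_def eq_fract)
  then have "Poly_Mapping.keys (Poly_Mapping.single (Poly_Mapping.single a (1::nat)) (1::rat)) =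
             Poly_Mapping.keys (Poly_Mapping.single (Poly_Mapping.single b (1::nat)) (1::rat))"
    by simp
  then have "Poly_Mapping.single a (1::nat) = Poly_Mapping.single b 1"
    by simp
  then have "Poly_Mapping.keys (Poly_Mapping.single a (1::nat)) =
             Poly_Mapping.keys (Poly_Mapping.single b (1::nat))"
    by simp
  then show "a = b" by simp
qed simp

lemma tvar_nonzero [simp]: "tvar a \<noteq> 0"
proof
  assume "tvar a = 0"
  then have "Poly_Mapping.keys (Poly_Mapping.single (Poly_Mapping.single a (1::nat)) (1::rat)) = {}"
    by (simp add: tvar_def Zero_fract_def eq_fract)
  then show False by simp
qed

lemma tratio_eq_1_iff [simp]: "tratio a b = 1 \<longleftrightarrow> a = b"
  by (simp add: tratio_def tvar_eq_iff)

lemma one_minus_tratio_nonzero: "a \<noteq> b \<Longrightarrow> 1 - tratio a b \<noteq> 0"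
  using tratio_eq_1_iff[of a b] by fastforce

lemma texp_qpow_diff: "texp (qpow a - qpow b) = tratio a b"
proof (cases "a = b")
  case False
  have l: "Poly_Mapping.lookup (qpow a - qpow b) r = (if r = a then 1 else if r = b then -1 else 0)" for r
    using False by (simp add: qpow_def lookup_minus lookup_single when_def)
  then have "Poly_Mapping.keys (qpow a - qpow b) = {a, b}"
    using False by (auto simp: in_keys_iff split: if_splits)
  with l False show ?thesis
    by (simp add: texp_def tratio_def divide_inverse)
qed (simp add: texp_def tratio_def)

lemma frob_tratio: "frob (tratio a b) = tratio (a + 1) (b + 1)"
proof -
  have "frob (tratio a b) * tvar (b + 1) = tvar (a + 1)"
    using frob_mult[of "tratio a b" "tvar b"] by (simp add: frob_tvar tratio_def)
  then show ?thesis
    by (simp add: tratio_def eq_divide_eq)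
qed

lemma frob_diff: "frob (x - y) = frob x - frob y"
  using frob_add[of "x - y" y] by simp

lemma frob_prod: "frob (\<Prod>i\<in>A. f i) = (\<Prod>i\<in>A. frob (f i))"
  by (induction A rule: infinite_finite_induct) (simp_all add: frob_1 frob_mult)

lemma q_bracket_tratio:
  "q_bracket (tratio a b) = (1 - tratio (a + 1) (b + 1)) / (1 - tratio a b)"
  by (simp add: q_bracket_def frob_tratio)

lemma qt_fact_eq: "qt_fact n = (\<Prod>i<n. 1 - tratio (int n) (int i))"
  by (simp add: qt_fact_def texp_qpow_diff)

lemma frob_funpow_qt_fact:
  "(frob ^^ k) (qt_fact m) = (\<Prod>i<m. 1 - tratio (int m + int k) (int i + int k))"
  by (induction k)
     (simp_all add: qt_fact_eq frob_prod frob_diff frob_1 frob_tratio algebra_simps)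

text \<open>
  The last \<open>n - k\<close> factors of \<open>n!\<close> are those of \<open>(n - k)!\<close> after \<open>k\<close> applications of the Frobenius
  automorphism, and cancel.
\<close>

lemma qt_binomial_eq_prod:
  assumes "k \<le> n"
  shows "qt_binomial n k =
    (\<Prod>i<k. (1 - tratio (int n) (int i)) / (1 - tratio (int k) (int i)))"
proof -
  let ?f = "\<lambda>i. 1 - tratio (int n) (int i)"
  have split: "(\<Prod>i<n. ?f i) = (\<Prod>i<k. ?f i) * (\<Prod>i<n - k. ?f (i + k))"
  proof -
    have "prod ?f {..<n} = prod ?f {..<k} * prod ?f {k..<n}"
      using assms by (simp add: prod.atLeastLessThan_concat lessThan_atLeast0)
    also have "prod ?f {k..<n} = (\<Prod>i<n - k. ?f (i + k))"
      using prod.shift_bounds_nat_ivl[of ?f 0 k "n - k"] assms by (simp add: lessThan_atLeast0)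
    finally show ?thesis .
  qed
  have "(\<Prod>i<n - k. ?f (i + k)) \<noteq> 0"
    using assms by (auto simp: prod_zero_iff)
  moreover have "(frob ^^ k) (qt_fact (n - k)) = (\<Prod>i<n - k. ?f (i + k))"
    using assms by (simp add: frob_funpow_qt_fact of_nat_diff)
  ultimately show ?thesis
    by (simp add: qt_binomial_def qt_fact_eq[of n] qt_fact_eq[of k] split prod_dividef)
qed

section \<open>Building partitions column by column\<close>

text \<open>
  The list \<open>add_column g l\<close> is meant for \<open>length l \<le> g\<close>. The ones at its end are the rows that meet only
  the new first column; \<open>remove_column\<close> therefore drops the parts equal to one.
\<close>

definition add_column :: "nat \<Rightarrow> nat list \<Rightarrow> nat list" where
  "add_column g l = map Suc l @ replicate (g - length l) 1"

definition remove_column :: "nat list \<Rightarrow> nat list" where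
  "remove_column l = map (\<lambda>x. x - 1) (filter (\<lambda>x. 1 < x) l)"

lemma length_add_column [simp]: "length l \<le> g \<Longrightarrow> length (add_column g l) = g"
  by (simp add: add_column_def)

lemma sum_list_add_column: "length l \<le> g \<Longrightarrow> sum_list (add_column g l) = g + sum_list l"
proof -
  have "sum_list (map Suc l) = length l + sum_list l"
    by (induction l) simp_all
  then show "length l \<le> g \<Longrightarrow> ?thesis"
    by (simp add: add_column_def sum_list_replicate)
qed

lemma remove_add_column: "0 \<notin> set l \<Longrightarrow> remove_column (add_column g l) = l"
proof -
  have "filter (\<lambda>x. 1 < x) (map Suc l) = map Suc l" if "0 \<notin> set l"
    using that by (induction l) auto
  then show "0 \<notin> set l \<Longrightarrow> ?thesis"
    by (simp add: add_column_def remove_column_def o_def)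
qed

lemma add_remove_column: "is_partition l \<Longrightarrow> add_column (length l) (remove_column l) = l"
proof (induction l)
  case (Cons x l)
  then have IH: "add_column (length l) (remove_column l) = l"
    by (simp add: is_partition_def)
  show ?case
  proof (cases "1 < x")
    case True
    then have "add_column (length (x # l)) (remove_column (x # l)) =
               x # add_column (length l) (remove_column l)"
      by (simp add: remove_column_def add_column_def)
    with IH show ?thesis by simp
  next
    case False
    with Cons.prems have x: "x = 1"
      by (cases x) (auto simp: is_partition_def)
    with Cons.prems have "y = 1" if "y \<in> set l" for y
      using that by (cases y) (auto simp: is_partition_def)
    then have "replicate (length l) 1 = l" "filter (\<lambda>x. 1 < x) l = []"
      by (auto simp: filter_empty_conv intro: replicate_eqI[symmetric])
    with x show ?thesis
      by (simp add: remove_column_def add_column_def)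
  qed
qed (simp add: add_column_def remove_column_def)

lemma add_column_box:
  assumes "l \<in> box_partitions g m" "g \<le> h"
  shows "add_column g l \<in> box_partitions h (Suc m)"
proof -
  have "sorted_wrt (\<ge>) (replicate n (1::nat))" for n
    by (induction n) auto
  with assms show ?thesis
    by (auto simp: box_partitions_def is_partition_def add_column_def sorted_wrt_append
          sorted_wrt_map)
qed

lemma remove_column_box:
  assumes "l \<in> box_partitions h (Suc m)"
  shows "remove_column l \<in> box_partitions (length l) m"
proof -
  have "sorted_wrt (\<ge>) (remove_column l)"
    using assms sorted_wrt_filter[of "(\<ge>)" l]
    by (auto simp: box_partitions_def is_partition_def remove_column_def sorted_wrt_map
             intro: sorted_wrt_mono_rel[of _ "(\<ge>)"] diff_le_mono)
  with assms show ?thesis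
    by (auto simp: box_partitions_def is_partition_def remove_column_def)
qed

text \<open>
  Removing the first column is a bijection. The height \<open>g\<close> of that column is the only constraint it
  puts on the rest, so the rest ranges over a box with \<open>g\<close> rows.
\<close>

lemma sum_box_partitions_Suc:
  "(\<Sum>l\<in>box_partitions h (Suc m). f l) =
   (\<Sum>g\<le>h. \<Sum>l\<in>box_partitions g m. f (add_column g l))"
proof -
  have "(\<Sum>l\<in>box_partitions h (Suc m). f l) =
        (\<Sum>(g, l)\<in>Sigma {..h} (\<lambda>g. box_partitions g m). f (add_column g l))"
    by (rule sum.reindex_bij_witness
          [where i = "\<lambda>(g, l). add_column g l" and j = "\<lambda>l. (length l, remove_column l)"])
       (auto simp: add_remove_column remove_add_column remove_column_box add_column_box,
        auto simp: box_partitions_def add_remove_column remove_add_column is_partition_def)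
  then show ?thesis
    by (simp add: sum.Sigma finite_box_partitions)
qed

lemma box_partitions_0 [simp]: "box_partitions h 0 = {[]}"
proof -
  have "l = []" if "0 \<notin> set l" "\<forall>p\<in>set l. p \<le> 0" for l :: "nat list"
    using that by (cases l) auto
  then show ?thesis
    by (auto simp: box_partitions_def is_partition_def)
qed

lemma box_partition_induct [consumes 1, case_names empty add_column]:
  assumes "l \<in> box_partitions h m"
    and "\<And>h. P h []"
    and "\<And>g h m l. g \<le> h \<Longrightarrow> l \<in> box_partitions g m \<Longrightarrow> P g l \<Longrightarrow> P h (add_column g l)"
  shows "P h l"
  using assms(1)
proof (induction m arbitrary: h l)
  case 0
  then show ?case by (simp add: assms(2))
next
  case (Suc m)
  then have "length l \<le> h" "is_partition l"
    by (simp_all add: box_partitions_def)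
  with assms(3)[OF _ remove_column_box[OF Suc.prems] Suc.IH[OF remove_column_box[OF Suc.prems]]]
  show ?case by (simp add: add_remove_column)
qed

section \<open>The weight of a column\<close>

text \<open>
  The product of the weights of the cells in a first column of height \<open>g\<close>: the cell in row \<open>i\<close> has
  \<open>r + d = k\<close> and \<open>d = k - i\<close>. The monomial in front comes from the bottom cell \<open>i = g\<close>; for \<open>g = 0\<close>,
  when there is no such cell, it is \<open>1\<close>, so an empty column needs no special treatment.
\<close>

definition col_wt :: "nat \<Rightarrow> nat \<Rightarrow> qhat" where
  "col_wt k g = tratio (int k) (int k - int g) *
     (\<Prod>i=1..g. q_bracket (tratio (int k) (int k - int i)))"

lemma cells_add_column:
  assumes "length l \<le> g"
  shows "cells (add_column g l) =
    (\<lambda>i. (i, 1)) ` {1..g} \<union> (\<lambda>(i, j). (i, Suc j)) ` cells l" (is "_ = ?R")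
proof -
  have "(i, j) \<in> cells (add_column g l) \<longleftrightarrow> (i, j) \<in> ?R" for i j
    using assms
    by (cases i; cases j)
       (auto simp: cells_def add_column_def nth_append image_iff Suc_le_eq)
  then show ?thesis by auto
qed

lemma cell_wt_tratio:
  "cell_wt l k (i, j) =
     (if is_bottom l (i, j) then tratio (int j + int k - 1) (int j + int k - 1 - int i) else 1) *
     q_bracket (tratio (int j + int k - 1) (int j + int k - 1 - int i))"
proof -
  have "texp (cell_e k (i, j)) = tratio (int j + int k - 1) (int j + int k - 1 - int i)"
    by (simp add: cell_e_def cell_r_def cell_d_def texp_qpow_diff algebra_simps)
  then show ?thesis by (simp add: cell_wt_def)
qed

lemma mem_cells_add_column:
  assumes "length l \<le> g"
  shows "(i, 1) \<in> cells (add_column g l) \<longleftrightarrow> i \<in> {1..g}"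
    and "j \<ge> 1 \<Longrightarrow> (i, Suc j) \<in> cells (add_column g l) \<longleftrightarrow> (i, j) \<in> cells l"
  unfolding cells_add_column[OF assms] by (auto simp: cells_def image_iff)

lemma is_bottom_add_column_1:
  assumes "length l \<le> g" "i \<in> {1..g}"
  shows "is_bottom (add_column g l) (i, 1) \<longleftrightarrow> i = g"
  using assms(2) by (auto simp only: is_bottom_def mem_cells_add_column[OF assms(1)]
      snd_conv fst_conv) (auto intro: antisym)

lemma is_bottom_add_column_Suc:
  assumes "length l \<le> g" "(i, j) \<in> cells l"
  shows "is_bottom (add_column g l) (i, Suc j) \<longleftrightarrow> is_bottom l (i, j)"
proof -
  have "j \<ge> 1"
    using assms(2) by (simp add: cells_def)
  then show ?thesis
    by (simp add: is_bottom_def mem_cells_add_column[OF assms(1)])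
qed

text \<open>
  The cells outside the first column sit one step further to the right than in \<open>l\<close>; since \<open>d\<close>
  contains \<open>j + k\<close>, this has the same effect on their weights as raising \<open>k\<close> by one.
\<close>

lemma wt_add_column:
  assumes "length l \<le> g"
  shows "wt (add_column g l) k = col_wt k g * wt l (Suc k)"
proof -
  let ?l = "add_column g l"
  have "wt ?l k = (\<Prod>x\<in>(\<lambda>i. (i, 1)) ` {1..g}. cell_wt ?l k x) *
                  (\<Prod>x\<in>(\<lambda>(i, j). (i, Suc j)) ` cells l. cell_wt ?l k x)"
    unfolding wt_def cells_add_column[OF assms]
    by (rule prod.union_disjoint) (simp_all add: finite_cells, auto simp: cells_def)
  moreover have "(\<Prod>x\<in>(\<lambda>i. (i, 1)) ` {1..g}. cell_wt ?l k x) = col_wt k g"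
  proof -
    have "(\<Prod>x\<in>(\<lambda>i. (i, 1)) ` {1..g}. cell_wt ?l k x) = (\<Prod>i=1..g. cell_wt ?l k (i, 1))"
      by (simp add: prod.reindex inj_on_def)
    also have "\<dots> = (\<Prod>i=1..g. (if i = g then tratio (int k) (int k - int g) else 1) *
                       q_bracket (tratio (int k) (int k - int i)))"
      by (rule prod.cong) (use is_bottom_add_column_1[OF assms] in \<open>auto simp: cell_wt_tratio\<close>)
    also have "\<dots> = col_wt k g"
      by (cases g) (simp_all add: prod.distrib prod.delta col_wt_def tratio_def)
    finally show ?thesis .
  qed
  moreover have "(\<Prod>x\<in>(\<lambda>(i, j). (i, Suc j)) ` cells l. cell_wt ?l k x) = wt l (Suc k)"
  proof -
    have "(\<Prod>x\<in>(\<lambda>(i, j). (i, Suc j)) ` cells l. cell_wt ?l k x) =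
          (\<Prod>x\<in>cells l. cell_wt ?l k (fst x, Suc (snd x)))"
      by (subst prod.reindex) (auto simp: inj_on_def case_prod_beta)
    also have "\<dots> = wt l (Suc k)"
      unfolding wt_def
      by (rule prod.cong)
         (use is_bottom_add_column_Suc[OF assms] in \<open>auto simp: cell_wt_tratio algebra_simps\<close>)
    finally show ?thesis .
  qed
  ultimately show ?thesis by simp
qed

lemma wt_Nil [simp]: "wt [] k = 1"
proof -
  have "cells [] = {}"
    by (auto simp: cells_def)
  then show ?thesis
    by (simp add: wt_def)
qed

section \<open>Summing over columns\<close>

definition box_prod :: "nat \<Rightarrow> nat \<Rightarrow> nat \<Rightarrow> qhat" where
  "box_prod k m h =
    (\<Prod>i=1..h. (1 - tratio (int k + int m) (int k - int i)) / (1 - tratio (int k) (int k - int i)))"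

text \<open>
  The brackets of the column weight have numerators \<open>1 - tratio (k + 1) (k + 1 - i)\<close>, which are the
  denominators of \<open>box_prod (k + 1) m g\<close>.
\<close>

lemma col_wt_times_box_prod:
  "col_wt k g * box_prod (Suc k) m g =
     tratio (int k) (int k - int g) *
     (\<Prod>i=1..g. (1 - tratio (int k + int m + 1) (int k + 1 - int i)) /
        (1 - tratio (int k) (int k - int i)))"
proof -
  have "q_bracket (tratio (int k) (int k - int i)) *
          ((1 - tratio (int (Suc k) + int m) (int (Suc k) - int i)) /
           (1 - tratio (int (Suc k)) (int (Suc k) - int i))) =
        (1 - tratio (int k + int m + 1) (int k + 1 - int i)) /
          (1 - tratio (int k) (int k - int i))"
    if "i \<in> {1..g}" for i
  proof -
    have "1 - tratio (int k + 1) (int k + 1 - int i) \<noteq> 0"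
      using that by (intro one_minus_tratio_nonzero) auto
    then show ?thesis
      by (simp add: q_bracket_tratio add.commute add.left_commute add_diff_eq diff_add_eq)
  qed
  then show ?thesis
    unfolding col_wt_def box_prod_def mult.assoc prod.distrib[symmetric]
    by (intro arg_cong2[of _ _ _ _ "(*)"] prod.cong refl)
qed

text \<open>
  After the cancellation, the numerators of the second summand are those of the first one
  shifted by one index. With \<open>x i\<close> for \<open>t^(q^(k-i))\<close>, \<open>y\<close> for \<open>t^(q^(k+m+1))\<close>, and \<open>A\<close> and \<open>B\<close> for
  the numerator and the denominator of the first summand, the claim becomes a rational identity
  in \<open>x 0\<close>, \<open>x (h + 1)\<close>, \<open>y\<close>, \<open>A\<close> and \<open>B\<close>; it rests on
  \<open>(1 - y / x (h + 1)) - (1 - x 0 / x (h + 1)) = x 0 / x (h + 1) * (1 - y / x 0)\<close>.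
\<close>

lemma box_prod_Suc:
  "box_prod k (Suc m) (Suc h) =
     box_prod k (Suc m) h + col_wt k (Suc h) * box_prod (Suc k) m (Suc h)"
proof -
  define x where "x i = tvar (int k - int i)" for i
  define y where "y = tvar (int k + int m + 1)"
  define A where "A = (\<Prod>i=1..h. 1 - y / x i)"
  define B where "B = (\<Prod>i=1..h. 1 - x 0 / x i)"
  have x: "x i \<noteq> 0" for i by (simp add: x_def)
  have ne: "1 - x 0 / x i \<noteq> 0" if "i \<noteq> 0" for i
    using one_minus_tratio_nonzero[of "int k" "int k - int i"] that by (simp add: x_def tratio_def)
  have B: "B \<noteq> 0"
    unfolding B_def using ne by (auto simp: prod_zero_iff)
  have L: "box_prod k (Suc m) j = (\<Prod>i=1..j. 1 - y / x i) / (\<Prod>i=1..j. 1 - x 0 / x i)" for j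
    by (simp add: box_prod_def prod_dividef x_def y_def tratio_def algebra_simps)
  have "(\<Prod>i=1..Suc h. 1 - y / x (i - 1)) = (1 - y / x 0) * A"
    unfolding A_def One_nat_def prod.atLeast_Suc_atMost_Suc_shift o_def
    by (simp add: prod.atLeast_Suc_atMost)
  moreover have "(\<Prod>i=1..Suc h. 1 - y / x (i - 1)) =
      (\<Prod>i=1..Suc h. 1 - tratio (int k + int m + 1) (int k + 1 - int i))"
    by (rule prod.cong) (auto simp: x_def y_def tratio_def of_nat_diff algebra_simps)
  ultimately have R: "col_wt k (Suc h) * box_prod (Suc k) m (Suc h) =
      x 0 / x (Suc h) * ((1 - y / x 0) * A / (B * (1 - x 0 / x (Suc h))))"
    unfolding col_wt_times_box_prod prod_dividef
    by (simp add: B_def x_def tratio_def)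
  have "A * (1 - y / x (Suc h)) / (B * (1 - x 0 / x (Suc h))) =
        A / B + x 0 / x (Suc h) * ((1 - y / x 0) * A / (B * (1 - x 0 / x (Suc h))))"
    using x[of 0] x[of "Suc h"] ne[of "Suc h"] B by (simp add: field_simps)
  then show ?thesis
    unfolding R L by (simp add: A_def B_def)
qed

lemma sum_col_wt_box_prod:
  "(\<Sum>g\<le>h. col_wt k g * box_prod (Suc k) m g) = box_prod k (Suc m) h"
  by (induction h) (simp_all add: box_prod_Suc, simp add: box_prod_def col_wt_def)

lemma box_prod_0: "box_prod k 0 h = 1"
  unfolding box_prod_def by (rule prod.neutral) (auto intro: one_minus_tratio_nonzero)

lemma sum_wt_box_partitions: "(\<Sum>l\<in>box_partitions h m. wt l k) = box_prod k m h"
proof (induction m arbitrary: h k)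
  case 0
  show ?case by (simp add: box_prod_0)
next
  case (Suc m)
  have "(\<Sum>l\<in>box_partitions h (Suc m). wt l k) =
        (\<Sum>g\<le>h. \<Sum>l\<in>box_partitions g m. col_wt k g * wt l (Suc k))"
    unfolding sum_box_partitions_Suc
    by (intro sum.cong refl wt_add_column) (simp add: box_partitions_def)
  also have "\<dots> = (\<Sum>g\<le>h. col_wt k g * box_prod (Suc k) m g)"
    by (simp add: Suc sum_distrib_left[symmetric])
  finally show ?case by (simp add: sum_col_wt_box_prod)
qed

lemma qt_binomial_eq_box_prod: "k \<le> n \<Longrightarrow> qt_binomial n k = box_prod k (n - k) k"
  unfolding qt_binomial_eq_prod box_prod_def
  by (rule prod.reindex_bij_witness[where i = "\<lambda>i. k - i" and j = "\<lambda>i. k - i"])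
     (auto simp: of_nat_diff)

section \<open>The limit \<open>t \<rightarrow> 1\<close>\<close>

text \<open>
  Limits of products require that \<open>poly_in_t\<close> is multiplicative. This holds because \<open>poly_in_t\<close> is
  the evaluation at \<open>t\<close> after embedding the coefficients as constants, as the recursion over \<open>pCons\<close>
  makes explicit.
\<close>

definition const_t :: "rat \<Rightarrow> (rat \<Rightarrow>\<^sub>0 rat) fract" where
  "const_t c = Fract (Poly_Mapping.single 0 c) 1"

lemma const_t_0 [simp]: "const_t 0 = 0"
  by (simp add: const_t_def Zero_fract_def)

lemma const_t_eq_0_iff: "const_t c = 0 \<longleftrightarrow> c = 0"
proof
  assume "const_t c = 0"
  then have "Poly_Mapping.lookup (Poly_Mapping.single (0::rat) c) 0 = 0"
    by (simp add: const_t_def Zero_fract_def eq_fract)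
  then show "c = 0" by simp
qed (simp add: const_t_0)

lemma const_t_mult: "const_t (a * b) = const_t a * const_t b"
  by (simp add: const_t_def mult_single)

lemma poly_in_t_eq_poly: "poly_in_t P = poly (map_poly const_t P) (tpower 1)"
  by (simp add: poly_in_t_def const_t_def[symmetric] poly_altdef degree_map_poly coeff_map_poly const_t_0 const_t_eq_0_iff)

lemma poly_in_t_pCons: "poly_in_t (pCons a P) = const_t a + tpower 1 * poly_in_t P"
  by (simp add: poly_in_t_eq_poly map_poly_pCons const_t_0)

lemma poly_in_t_0 [simp]: "poly_in_t 0 = 0"
  by (simp add: poly_in_t_eq_poly)

lemma poly_in_t_1 [simp]: "poly_in_t 1 = 1"
  by (simp add: one_pCons poly_in_t_pCons const_t_def One_fract_def)

lemma poly_in_t_add: "poly_in_t (P + Q) = poly_in_t P + poly_in_t Q"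
  by (induction P Q rule: poly_induct2)
     (simp_all add: poly_in_t_pCons const_t_def single_add algebra_simps)

lemma poly_in_t_diff: "poly_in_t (P - Q) = poly_in_t P - poly_in_t Q"
  using poly_in_t_add[of "P - Q" Q] by simp

lemma poly_in_t_smult: "poly_in_t (smult c P) = const_t c * poly_in_t P"
  by (induction P) (simp_all add: poly_in_t_pCons const_t_mult algebra_simps)

lemma poly_in_t_mult: "poly_in_t (P * Q) = poly_in_t P * poly_in_t Q"
  by (induction P)
     (simp_all add: poly_in_t_pCons poly_in_t_add poly_in_t_smult algebra_simps const_t_0)

lemma poly_in_t_eq_0_iff [simp]: "poly_in_t P = 0 \<longleftrightarrow> P = 0"
  using poly_in_t_inject[of P 0] by auto

lemma poly_in_t_monom: "poly_in_t (monom 1 n) = tpower (of_nat n)"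
proof (induction n)
  case 0
  show ?case
    by (simp add: tpower_def monom_0 poly_in_t_pCons const_t_def)
next
  case (Suc n)
  then show ?case
    by (simp add: monom_Suc poly_in_t_pCons const_t_0 tpower_def mult_single)
qed

abbreviation t1_graph :: "nat \<Rightarrow> qhat \<Rightarrow> rat poly \<Rightarrow> bool" where
  "t1_graph q F P \<equiv> hom_graph (range (\<lambda>r. (tvar r, tpower (of_nat q powi r)))) F (poly_in_t P)"

text \<open>
  This is how a quotient of two elements of the field acquires a polynomial image: the image of the
  denominator must divide that of the numerator among polynomials, not only be nonzero.
\<close>

lemma t1_graph_divide:
  assumes "t1_graph q F P" "t1_graph q F' P'" "P' \<noteq> 0" "P = R * P'"
  shows "t1_graph q (F / F') R"
proof -
  have "poly_in_t R = poly_in_t P * inverse (poly_in_t P')"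
    using assms(3,4) by (simp add: poly_in_t_mult)
  with assms show ?thesis
    by (simp add: divide_inverse hom_graph.mult hom_graph.inv)
qed

text \<open>
  With nonnegative indices \<open>b \<le> a\<close>, the exponent \<open>q^a - q^b\<close> is a natural number, so the image is a
  monomial.
\<close>

lemma t1_graph_tratio:
  assumes "q > 0" "b \<le> a"
  shows "t1_graph q (tratio (int a) (int b)) (monom 1 (q ^ a - q ^ b))"
proof -
  have tv: "t1_graph q (tvar (int c)) (monom 1 (q ^ c))" for c
    by (rule hom_graph.gen) (auto simp: poly_in_t_monom image_iff intro!: exI[of _ "int c"])
  have "q ^ b \<le> q ^ a"
    using assms by (intro power_increasing) auto
  then show ?thesis
    unfolding tratio_def
    by (intro t1_graph_divide[OF tv tv]) (simp_all add: mult_monom monom_eq_0_iff)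
qed

lemma lim_t1_mult:
  assumes "lim_t1 q F c" "lim_t1 q F' c'"
  shows "lim_t1 q (F * F') (c * c')"
proof -
  obtain P P' where "t1_graph q F P" "poly P 1 = c" "t1_graph q F' P'" "poly P' 1 = c'"
    using assms unfolding lim_t1_def by blast
  then show ?thesis
    unfolding lim_t1_def
    by (intro exI[of _ "P * P'"]) (simp add: poly_in_t_mult hom_graph.mult)
qed

lemma lim_t1_1: "lim_t1 q 1 1"
  unfolding lim_t1_def by (rule exI[of _ 1]) (simp add: hom_graph.one)

lemma lim_t1_prod:
  "(\<And>i. i \<in> A \<Longrightarrow> lim_t1 q (f i) (c i)) \<Longrightarrow> lim_t1 q (\<Prod>i\<in>A. f i) (\<Prod>i\<in>A. c i)"
  by (induction A rule: infinite_finite_induct) (auto intro: lim_t1_1 lim_t1_mult)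

lemma lim_t1_tratio:
  assumes "q > 0" "b \<le> a"
  shows "lim_t1 q (tratio (int a) (int b)) 1"
  unfolding lim_t1_def using t1_graph_tratio[OF assms] by (auto simp: poly_monom)

text \<open>
  Put \<open>e = q^a - q^b\<close>. The Frobenius automorphism multiplies the exponent by \<open>q\<close>, so the bracket becomes
  \<open>(1 - t^(e q)) / (1 - t^e)\<close>, the geometric sum of the \<open>q\<close> powers \<open>t^(e s)\<close> with \<open>s < q\<close>. The condition
  \<open>q \<ge> 2\<close> gives \<open>e > 0\<close>, without which the denominator would vanish.
\<close>

lemma lim_t1_q_bracket:
  assumes "q \<ge> 2" "b < a"
  shows "lim_t1 q (q_bracket (tratio (int a) (int b))) (of_nat q)"
proof -
  define e where "e = q ^ a - q ^ b"
  define R :: "rat poly" where "R = (\<Sum>s<q. monom 1 e ^ s)"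
  have "e > 0"
    using assms by (simp add: e_def)
  have e': "q ^ Suc a - q ^ Suc b = e * q"
    by (simp add: e_def algebra_simps)
  have "t1_graph q (1 - tratio (int a + 1) (int b + 1)) (1 - monom 1 (e * q))"
    using t1_graph_tratio[of q "Suc b" "Suc a"] assms
    by (simp only: e' poly_in_t_diff poly_in_t_1)
       (auto intro!: hom_graph.diff hom_graph.one simp: algebra_simps)
  moreover have "t1_graph q (1 - tratio (int a) (int b)) (1 - monom 1 e)"
    using t1_graph_tratio[of q b a] assms
    by (auto simp: e_def poly_in_t_diff intro!: hom_graph.diff hom_graph.one)
  moreover have "1 - monom 1 e \<noteq> (0 :: rat poly)"
  proof
    assume "1 - monom 1 e = (0 :: rat poly)"
    then have "coeff (1 - monom 1 e) e = (0 :: rat)" by simp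
    with \<open>e > 0\<close> show False by (simp add: coeff_1)
  qed
  moreover have "1 - monom 1 (e * q) = R * (1 - monom 1 e)"
    using one_diff_power_eq[of "monom (1::rat) e" q]
    by (simp add: R_def monom_power mult.commute)
  ultimately have "t1_graph q (q_bracket (tratio (int a) (int b))) R"
    unfolding q_bracket_tratio by (rule t1_graph_divide)
  moreover have "poly R 1 = of_nat q"
    by (simp add: R_def poly_sum poly_monom)
  ultimately show ?thesis
    unfolding lim_t1_def by blast
qed

text \<open>
  The assumption \<open>g \<le> k\<close> keeps all indices \<open>k - i\<close> nonnegative, hence all exponents natural numbers.
\<close>

lemma lim_t1_col_wt:
  assumes "q \<ge> 2" "g \<le> k"
  shows "lim_t1 q (col_wt k g) (of_nat q ^ g)"
proof -
  have "lim_t1 q (q_bracket (tratio (int k) (int k - int i))) (of_nat q)" if "i \<in> {1..g}" for i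
    using lim_t1_q_bracket[of q "k - i" k] that assms by (simp add: of_nat_diff)
  then have "lim_t1 q (\<Prod>i=1..g. q_bracket (tratio (int k) (int k - int i))) (\<Prod>i=1..g. of_nat q)"
    by (rule lim_t1_prod)
  moreover have "lim_t1 q (tratio (int k) (int k - int g)) 1"
    using lim_t1_tratio[of q "k - g" k] assms by (simp add: of_nat_diff)
  ultimately show ?thesis
    using lim_t1_mult by (fastforce simp: col_wt_def)
qed

lemma lim_t1_wt:
  assumes "l \<in> box_partitions h m" "h \<le> k" "q \<ge> 2"
  shows "lim_t1 q (wt l k) (of_nat q ^ sum_list l)"
  using assms(1,2)
proof (induction arbitrary: k rule: box_partition_induct)
  case (empty h)
  show ?case by (simp add: lim_t1_1)
next
  case (add_column g h m l)
  then have "length l \<le> g" by (simp add: box_partitions_def)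
  moreover have "lim_t1 q (col_wt k g * wt l (Suc k)) (of_nat q ^ g * of_nat q ^ sum_list l)"
    using add_column assms(3) by (intro lim_t1_mult lim_t1_col_wt add_column.IH) auto
  ultimately show ?case
    by (simp add: wt_add_column sum_list_add_column power_add)
qed

section \<open>The limit \<open>q \<rightarrow> 1\<close>\<close>

lemma ratfun_t_power: "ratfun_t ^ n = Fract (monom 1 n) 1"
  by (induction n) (simp_all add: ratfun_t_def One_fract_def monom_Suc)

lemma ratfun_t_power_neq_1: "n > 0 \<Longrightarrow> ratfun_t ^ n \<noteq> 1"
proof
  assume "n > 0" "ratfun_t ^ n = 1"
  then have "monom 1 n = (1 :: rat poly)"
    by (simp add: ratfun_t_power One_fract_def eq_fract)
  then have "coeff (monom 1 n) 0 = coeff (1 :: rat poly) 0" by simp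
  with \<open>n > 0\<close> show False by simp
qed

lemma lim_q1_tratio: "lim_q1 (tratio a (a - int i)) (ratfun_t ^ i)"
  unfolding lim_q1_def tratio_def
  by (rule hom_graph.gen) (force intro: exI[of _ a] exI[of _ "a - int i"])

text \<open>
  Only the difference of the two indices matters for the limit, and the Frobenius automorphism
  preserves it; numerator and denominator therefore have the same image.
\<close>

lemma lim_q1_q_bracket:
  assumes "i > 0"
  shows "lim_q1 (q_bracket (tratio a (a - int i))) 1"
proof -
  have "1 - ratfun_t ^ i \<noteq> 0"
    using ratfun_t_power_neq_1[OF assms] by simp
  moreover have d: "lim_q1 (1 - tratio b (b - int i)) (1 - ratfun_t ^ i)" for b
    using lim_q1_tratio[of b i] unfolding lim_q1_def by (rule hom_graph.diff[OF hom_graph.one])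
  ultimately have "lim_q1 ((1 - tratio (a + 1) (a + 1 - int i)) * inverse (1 - tratio a (a - int i)))
      ((1 - ratfun_t ^ i) * inverse (1 - ratfun_t ^ i))"
    using d[of a] d[of "a + 1"] unfolding lim_q1_def by (intro hom_graph.mult hom_graph.inv)
  with \<open>1 - ratfun_t ^ i \<noteq> 0\<close> show ?thesis
    by (simp add: q_bracket_tratio divide_inverse diff_add_eq)
qed

lemma lim_q1_mult: "lim_q1 F f \<Longrightarrow> lim_q1 F' f' \<Longrightarrow> lim_q1 (F * F') (f * f')"
  unfolding lim_q1_def by (rule hom_graph.mult)

lemma lim_q1_col_wt: "lim_q1 (col_wt k g) (ratfun_t ^ g)"
proof -
  have "lim_q1 (\<Prod>i=1..g. q_bracket (tratio (int k) (int k - int i))) (\<Prod>i=1..g. 1)"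
    unfolding lim_q1_def
    by (rule hom_graph_prod) (use lim_q1_q_bracket in \<open>simp add: lim_q1_def\<close>)
  from lim_q1_mult[OF lim_q1_tratio[of "int k" g] this] show ?thesis
    by (simp add: col_wt_def)
qed

lemma lim_q1_wt:
  assumes "l \<in> box_partitions h m"
  shows "lim_q1 (wt l k) (ratfun_t ^ sum_list l)"
  using assms
proof (induction arbitrary: k rule: box_partition_induct)
  case (empty h)
  show ?case by (simp add: lim_q1_def hom_graph.one)
next
  case (add_column g h m l)
  then have "length l \<le> g" by (simp add: box_partitions_def)
  with lim_q1_mult[OF lim_q1_col_wt[of k g] add_column.IH[of "Suc k"]] show ?case
    by (simp add: wt_add_column sum_list_add_column power_add)
qed

theorem theorem5p3:
  fixes n k :: nat
  assumes "k \<le> n"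
  shows "qt_binomial n k = (\<Sum>l\<in>box_partitions k (n - k). wt l k) \<and>
    (\<forall>l\<in>box_partitions k (n - k).
       (\<forall>q::nat. q \<ge> 2 \<longrightarrow> lim_t1 q (wt l k) (of_nat q ^ sum_list l)) \<and>
       lim_q1 (wt l k) (ratfun_t ^ sum_list l))"
  using qt_binomial_eq_box_prod[OF assms] lim_t1_wt lim_q1_wt
  by (auto simp: sum_wt_box_partitions)

end
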